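(* Let $(\Omega,\mathcal{F},\tau)$ be a PM-space and let $\Sigma=P(\Omega)$ be the power set of $\Omega$. Then $\Lambda^{\mathcal{H}}:\Sigma\to\Delta^+$ is an antimonotone set function (i.e. $\Lambda^{\mathcal{H}}_E\geq\Lambda^{\mathcal{H}}_F$ whenever $E\subseteq F$) with $\Lambda^{\mathcal{H}}_\emptyset=\varepsilon_0$ and $$\Lambda^{\mathcal{H}}_{E\cup F}\leq\Pi_M\left(\Lambda^{\mathcal{H}}_E,\Lambda^{\mathcal{H}}_F\right),\qquad E,F\in\Sigma.$$
   Context: $\Delta^+$ is the set of distance distribution functions: all $F:[-\infty,+\infty]\to[0,1]$ that are non-decreasing, left-continuous on $\mathbb{R}$, with $F(-\infty)=0$, $F(0)=0$ and $F(+\infty)=1$ (so an element is determined by its values on $]0,+\infty[$). It is ordered pointwise. The element $\varepsilon_0\in\Delta^+$ is given by $\varepsilon_0(x)=1$ for $x>0$ and $\varepsilon_0(x)=0$ otherwise. A triangle function is a mapping $\tau:\Delta^+\times\Delta^+\to\Delta^+$ that is symmetric, associative, non-decreasing in each variable, and has $\varepsilon_0$ as identity. $\Pi_M$ is the triangle function $\Pi_M(G,H)(t)=M(G(t),H(t))$, where $M(x,y)=\min\{x,y\}$. A probabilistic metric space (PM-space) $(\Omega,\mathcal{F},\tau)$ is a non-empty set $\Omega$ with a triangle function $\tau$ and a family $\mathcal{F}$ of functions $H_{p,q}\in\Delta^+$ ($p,q\in\Omega$) such that for all $p,q,r\in\Omega$: $H_{p,q}=\varepsilon_0$ iff $p=q$;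 $H_{p,q}=H_{q,p}$; $H_{p,r}\geq\tau(H_{p,q},H_{q,r})$. The probabilistic Hausdorff distance between $E,F\subseteq\Omega$ is $\mathcal{H}_{E,F}(0)=0$ and, for $t\in]0,+\infty[$, $$\mathcal{H}_{E,F}(t)=\sup_{s<t}M\Bigl(\inf_{p\in E}\sup_{q\in F}H_{p,q}(s),\ \inf_{q\in F}\sup_{p\in E}H_{p,q}(s)\Bigr),$$ where, in $[0,1]$, a supremum over the empty set is $0$ and an infimum over the empty set is $1$; it is regarded as an element of $\Delta^+$ by setting it $0$ on negative arguments and $1$ at $+\infty$. Define $\Lambda^{\mathcal{H}}:\Sigma\to\Delta^+$ by $\Lambda^{\mathcal{H}}_E:=\mathcal{H}_{E^c,\Omega}$, where $E^c=\Omega\setminus E$. *)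

theory Defs
  imports "HOL-Library.Extended_Real" "HOL-Library.FuncSet"
begin

text \<open>
  Distance distribution functions are functions on the extended reals with real values in the unit
  interval. Their pointwise order is the library order on functions.
  Left-continuity is demanded at real points only, so there may be a jump at \<open>\<infinity>\<close>.
\<close>

definition Delta_plus :: "(ereal \<Rightarrow> real) set" where
  "Delta_plus = {F. range F \<subseteq> {0..1} \<and> mono F \<and>
     (\<forall>x::real. continuous (at_left (ereal x)) F) \<and>
     F (-\<infinity>) = 0 \<and> F 0 = 0 \<and> F \<infinity> = 1}"

definition eps0 :: "ereal \<Rightarrow> real" where
  "eps0 x = (if x > 0 then 1 else 0)"

definition triangle_function ::
  "((ereal \<Rightarrow> real) \<Rightarrow> (ereal \<Rightarrow> real) \<Rightarrow> (ereal \<Rightarrow> real)) \<Rightarrow> bool" where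
  "triangle_function \<tau> \<longleftrightarrow>
     (\<forall>F\<in>Delta_plus. \<forall>G\<in>Delta_plus. \<tau> F G \<in> Delta_plus) \<and>
     (\<forall>F\<in>Delta_plus. \<forall>G\<in>Delta_plus. \<tau> F G = \<tau> G F) \<and>
     (\<forall>F\<in>Delta_plus. \<forall>G\<in>Delta_plus. \<forall>K\<in>Delta_plus. \<tau> (\<tau> F G) K = \<tau> F (\<tau> G K)) \<and>
     (\<forall>F\<in>Delta_plus. \<forall>F'\<in>Delta_plus. \<forall>G\<in>Delta_plus.
        F \<le> F' \<longrightarrow> \<tau> F G \<le> \<tau> F' G \<and> \<tau> G F \<le> \<tau> G F') \<and>
     (\<forall>F\<in>Delta_plus. \<tau> F eps0 = F \<and> \<tau> eps0 F = F)"

definition Pi_M :: "(ereal \<Rightarrow> real) \<Rightarrow> (ereal \<Rightarrow> real) \<Rightarrow> ereal \<Rightarrow> real" where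
  "Pi_M G H t = min (G t) (H t)"

locale PM_space =
  fixes \<Omega> :: "'a set"
    and H :: "'a \<Rightarrow> 'a \<Rightarrow> ereal \<Rightarrow> real"
    and \<tau> :: "(ereal \<Rightarrow> real) \<Rightarrow> (ereal \<Rightarrow> real) \<Rightarrow> (ereal \<Rightarrow> real)"
  assumes nonempty: "\<Omega> \<noteq> {}"
    and triangle_function: "triangle_function \<tau>"
    and in_Delta_plus: "\<And>p q. p \<in> \<Omega> \<Longrightarrow> q \<in> \<Omega> \<Longrightarrow> H p q \<in> Delta_plus"
    and eq_eps0_iff: "\<And>p q. p \<in> \<Omega> \<Longrightarrow> q \<in> \<Omega> \<Longrightarrow> H p q = eps0 \<longleftrightarrow> p = q"
    and sym: "\<And>p q. p \<in> \<Omega> \<Longrightarrow> q \<in> \<Omega> \<Longrightarrow> H p q = H q p"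
    and triangle: "\<And>p q r. p \<in> \<Omega> \<Longrightarrow> q \<in> \<Omega> \<Longrightarrow> r \<in> \<Omega> \<Longrightarrow> \<tau> (H p q) (H q r) \<le> H p r"

text \<open>
  Supremum and infimum of subsets of the complete lattice \<open>{0..1}\<close>; the library's real \<open>Sup\<close> and
  \<open>Inf\<close> are unspecified on the empty set.
\<close>

definition sup01 :: "real set \<Rightarrow> real" where
  "sup01 A = (if A = {} then 0 else Sup A)"

definition inf01 :: "real set \<Rightarrow> real" where
  "inf01 A = (if A = {} then 1 else Inf A)"

definition prob_hausdorff ::
  "('a \<Rightarrow> 'a \<Rightarrow> ereal \<Rightarrow> real) \<Rightarrow> 'a set \<Rightarrow> 'a set \<Rightarrow> ereal \<Rightarrow> real" where
  "prob_hausdorff H E F t =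
     (if t \<le> 0 then 0 else if t = \<infinity> then 1
      else sup01 ((\<lambda>s. min (inf01 ((\<lambda>p. sup01 ((\<lambda>q. H p q s) ` F)) ` E))
                            (inf01 ((\<lambda>q. sup01 ((\<lambda>p. H p q s) ` E)) ` F))) ` {..<t}))"

definition Lambda_H ::
  "'a set \<Rightarrow> ('a \<Rightarrow> 'a \<Rightarrow> ereal \<Rightarrow> real) \<Rightarrow> 'a set \<Rightarrow> ereal \<Rightarrow> real" where
  "Lambda_H \<Omega> H E = prob_hausdorff H (\<Omega> - E) \<Omega>"

end

theory Submission
  imports Defs
begin

text \<open>
  Comparing a set \<open>A \<subseteq> \<Omega>\<close> with the whole space, only the term measuring how well \<open>A\<close> approximates
  the points of \<open>\<Omega>\<close> matters: the other one is \<open>1\<close> at every \<open>s > 0\<close>, since each \<open>p \<in> A\<close> may be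
  paired with itself, and at \<open>s \<le> 0\<close> the first one already vanishes. The remaining term is visibly
  monotone in \<open>A\<close>, and the inequality for unions follows from antimonotonicity alone.
\<close>

section \<open>Suprema and infima in the unit interval\<close>

lemma sup01_upper: "A \<subseteq> {0..1} \<Longrightarrow> a \<in> A \<Longrightarrow> a \<le> sup01 A"
  unfolding sup01_def by (auto intro!: cSup_upper bdd_aboveI[of _ 1])

text \<open>The side condition \<open>0 \<le> b\<close> handles empty \<open>A\<close>, where the
  supremum is 0 by convention; \<open>b \<le> 1\<close> in \<open>inf01_greatest\<close> is its
  dual.\<close>

lemma sup01_least: "(\<And>a. a \<in> A \<Longrightarrow> a \<le> b) \<Longrightarrow> 0 \<le> b \<Longrightarrow> sup01 A \<le> b"
  unfolding sup01_def by (auto intro!: cSup_least)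

lemma inf01_lower: "A \<subseteq> {0..1} \<Longrightarrow> a \<in> A \<Longrightarrow> inf01 A \<le> a"
  unfolding inf01_def by (auto intro!: cInf_lower bdd_belowI[of _ 0])

lemma inf01_greatest: "(\<And>a. a \<in> A \<Longrightarrow> b \<le> a) \<Longrightarrow> b \<le> 1 \<Longrightarrow> b \<le> inf01 A"
  unfolding inf01_def by (auto intro!: cInf_greatest)

lemma sup01_range: "A \<subseteq> {0..1} \<Longrightarrow> sup01 A \<in> {0..1}"
proof -
  assume A: "A \<subseteq> {0..1}"
  have "0 \<le> sup01 A"
  proof (cases "A = {}")
    case True
    then show ?thesis by (simp add: sup01_def)
  next
    case False
    then obtain a where "a \<in> A" by blast
    with A show ?thesis using sup01_upper[OF A, of a] by fastforce
  qed
  moreover have "sup01 A \<le> 1" using A by (intro sup01_least) auto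
  ultimately show ?thesis by simp
qed

lemma inf01_range: "A \<subseteq> {0..1} \<Longrightarrow> inf01 A \<in> {0..1}"
proof -
  assume A: "A \<subseteq> {0..1}"
  have "inf01 A \<le> 1"
  proof (cases "A = {}")
    case True
    then show ?thesis by (simp add: inf01_def)
  next
    case False
    then obtain a where "a \<in> A" by blast
    with A show ?thesis using inf01_lower[OF A, of a] by fastforce
  qed
  moreover have "0 \<le> inf01 A" using A by (intro inf01_greatest) auto
  ultimately show ?thesis by simp
qed

lemma sup01_image_mono:
  assumes "A \<subseteq> B" and "g ` B \<subseteq> {0..1}" and "\<And>x. x \<in> A \<Longrightarrow> f x \<le> g x"
  shows "sup01 (f ` A) \<le> sup01 (g ` B)"
proof (rule sup01_least)
  fix a assume "a \<in> f ` A"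
  then obtain x where x: "x \<in> A" "a = f x" by blast
  then have "g x \<le> sup01 (g ` B)" using assms(1,2) by (intro sup01_upper) auto
  then show "a \<le> sup01 (g ` B)" using assms(3)[of x] x by simp
qed (use sup01_range[OF assms(2)] in simp)

lemma inf01_image_mono:
  assumes "f ` A \<subseteq> {0..1}" and "\<And>x. x \<in> A \<Longrightarrow> f x \<le> g x"
  shows "inf01 (f ` A) \<le> inf01 (g ` A)"
proof (rule inf01_greatest)
  fix a assume "a \<in> g ` A"
  then obtain x where x: "x \<in> A" "a = g x" by blast
  then have "inf01 (f ` A) \<le> f x" using assms(1) by (intro inf01_lower) auto
  then show "inf01 (f ` A) \<le> a" using assms(2)[of x] x by simp
qed (use inf01_range[OF assms(1)] in simp)

section \<open>Left regularization and membership in Delta^+\<close>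

text \<open>This is the outer layer of \<open>prob_hausdorff\<close>, split off so that the defining
  properties of Delta^+ can be checked for an arbitrary unit-interval-valued
  \<open>g\<close>.\<close>

definition left_regularization :: "(ereal \<Rightarrow> real) \<Rightarrow> ereal \<Rightarrow> real" where
  "left_regularization g t =
     (if t \<le> 0 then 0 else if t = \<infinity> then 1 else sup01 (g ` {..<t}))"

lemma left_regularization_range:
  assumes "range g \<subseteq> {0..1}"
  shows "left_regularization g t \<in> {0..1}"
proof -
  have "g ` {..<t} \<subseteq> {0..1}" using assms by auto
  from sup01_range[OF this] show ?thesis by (simp add: left_regularization_def)
qed

lemma left_regularization_upper:
  assumes "range g \<subseteq> {0..1}" and "0 < t" and "s < t"
  shows "g s \<le> left_regularization g t"
proof (cases "t = \<infinity>")
  case True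
  then show ?thesis using subsetD[OF assms(1) rangeI[of g s]] by (simp add: left_regularization_def)
next
  case False
  then show ?thesis using assms by (auto simp: left_regularization_def intro!: sup01_upper)
qed

lemma left_regularization_mono:
  assumes "range g \<subseteq> {0..1}" and "\<And>s. f s \<le> g s"
  shows "left_regularization f \<le> left_regularization g"
proof (rule le_funI)
  fix t
  have "sup01 (f ` {..<t}) \<le> sup01 (g ` {..<t})"
    using assms by (intro sup01_image_mono) auto
  then show "left_regularization f t \<le> left_regularization g t"
    by (simp add: left_regularization_def)
qed

lemma mono_left_regularization:
  assumes "range g \<subseteq> {0..1}"
  shows "mono (left_regularization g)"
proof (rule monoI)
  fix t u :: ereal assume "t \<le> u"
  note rng = left_regularization_range[OF assms, of t] left_regularization_range[OF assms, of u]
  \<comment> \<open>The first two cases compare with the prescribed extreme values 0 and 1, so the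
    range suffices; in the third, both sides are suprema over nested index sets.\<close>
  consider "t \<le> 0" | "u = \<infinity>" | "0 < t" "u \<noteq> \<infinity>" by force
  then show "left_regularization g t \<le> left_regularization g u"
  proof cases
    case 1
    then show ?thesis using rng by (simp add: left_regularization_def)
  next
    case 2
    then show ?thesis using rng by (simp add: left_regularization_def)
  next
    case 3
    then have "0 < u" "t \<noteq> \<infinity>" using \<open>t \<le> u\<close> by auto
    have "sup01 (g ` {..<t}) \<le> sup01 (g ` {..<u})"
      using assms \<open>t \<le> u\<close> by (intro sup01_image_mono) auto
    then show ?thesis using 3 \<open>0 < u\<close> \<open>t \<noteq> \<infinity>\<close> by (auto simp: left_regularization_def dest: leD)
  qed
qed

text \<open>A number below the supremum over all \<open>s < x\<close> is already exceeded by a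
  single \<open>g s\<close>, and this \<open>g s\<close> bounds the value from below at every
  positive \<open>t\<close> between \<open>s\<close> and \<open>x\<close>. The upper estimate is
  monotonicity.\<close>

lemma left_regularization_left_continuous:
  assumes "range g \<subseteq> {0..1}"
  shows "continuous (at_left (ereal x)) (left_regularization g)"
  unfolding continuous_within
proof (rule order_tendstoI)
  let ?F = "left_regularization g"
  fix a assume a: "a < ?F (ereal x)"
  show "\<forall>\<^sub>F t in at_left (ereal x). a < ?F t"
  \<comment> \<open>If \<open>a\<close> is nonnegative, then the value at \<open>x\<close> is
    positive, which forces \<open>x > 0\<close>; nonnegativity is also what
    \<open>sup01_least\<close> asks of the bound \<open>a\<close>.\<close>
  proof (cases "a < 0")
    case True
    have "a < ?F t" for t
      using True left_regularization_range[OF assms, of t] by simp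
    then show ?thesis by simp
  next
    case False
    with a have x: "0 < ereal x" and sup: "a < sup01 (g ` {..<ereal x})"
      unfolding left_regularization_def by (auto split: if_splits)
    have "\<not> (\<forall>s<ereal x. g s \<le> a)"
      using sup01_least[of "g ` {..<ereal x}" a] sup False by auto
    then obtain s where s: "s < ereal x" "a < g s" by (meson not_le)
    \<comment> \<open>The left endpoint is cut off at 0 because
      \<open>left_regularization_upper\<close> applies to positive \<open>t\<close> only.\<close>
    have "\<forall>\<^sub>F t in at_left (ereal x). t \<in> {max 0 s<..<ereal x}"
      using s(1) x by (intro eventually_at_leftI[of "max 0 s"]) simp_all
    then show ?thesis
    proof (rule eventually_mono)
      fix t assume "t \<in> {max 0 s<..<ereal x}"
      then have "g s \<le> ?F t" using left_regularization_upper[OF assms, of t s] by simp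
      with s show "a < ?F t" by simp
    qed
  qed
next
  let ?F = "left_regularization g"
  fix a assume a: "?F (ereal x) < a"
  have "\<forall>\<^sub>F t in at_left (ereal x). t < ereal x"
    by (simp add: eventually_at_filter)
  then show "\<forall>\<^sub>F t in at_left (ereal x). ?F t < a"
  proof (rule eventually_mono)
    fix t assume "t < ereal x"
    then have "?F t \<le> ?F (ereal x)"
      by (intro monoD[OF mono_left_regularization[OF assms]]) simp
    with a show "?F t < a" by simp
  qed
qed

lemma left_regularization_in_Delta_plus:
  assumes "range g \<subseteq> {0..1}"
  shows "left_regularization g \<in> Delta_plus"
proof -
  have "range (left_regularization g) \<subseteq> {0..1}"
    using left_regularization_range[OF assms] by blast
  moreover have "left_regularization g (-\<infinity>) = 0" "left_regularization g 0 = 0"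
    "left_regularization g \<infinity> = 1"
    by (simp_all add: left_regularization_def)
  ultimately show ?thesis
    unfolding Delta_plus_def
    using mono_left_regularization[OF assms] left_regularization_left_continuous[OF assms]
    by blast
qed

section \<open>Covering functions of subsets of a PM-space\<close>

context PM_space
begin

text \<open>The second argument of \<open>min\<close> in \<open>prob_hausdorff H A \<Omega>\<close>:
  how well \<open>A\<close> approximates the worst point of the space at scale
  \<open>s\<close>.\<close>

definition cover :: "'a set \<Rightarrow> ereal \<Rightarrow> real" where
  "cover A s = inf01 ((\<lambda>q. sup01 ((\<lambda>p. H p q s) ` A)) ` \<Omega>)"

lemma H_range: "p \<in> \<Omega> \<Longrightarrow> q \<in> \<Omega> \<Longrightarrow> H p q s \<in> {0..1}"
  using in_Delta_plus unfolding Delta_plus_def by blast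

lemma H_nonpos:
  assumes "p \<in> \<Omega>" "q \<in> \<Omega>" "s \<le> 0"
  shows "H p q s = 0"
proof -
  have "mono (H p q)" "H p q 0 = 0"
    using in_Delta_plus[OF assms(1,2)] by (auto simp: Delta_plus_def)
  then have "H p q s \<le> 0" using assms(3) by (metis monoD)
  then show ?thesis using H_range[OF assms(1,2), of s] by simp
qed

lemma H_self_pos: "p \<in> \<Omega> \<Longrightarrow> 0 < s \<Longrightarrow> H p p s = 1"
  using eq_eps0_iff[of p p] by (simp add: eps0_def)

lemma sup01_H_range:
  "A \<subseteq> \<Omega> \<Longrightarrow> q \<in> \<Omega> \<Longrightarrow> sup01 ((\<lambda>p. H p q s) ` A) \<in> {0..1}"
  using H_range by (intro sup01_range) blast

lemma cover_range: "A \<subseteq> \<Omega> \<Longrightarrow> cover A s \<in> {0..1}"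
  unfolding cover_def using sup01_H_range by (intro inf01_range) blast

lemma cover_mono:
  assumes "A \<subseteq> B" "B \<subseteq> \<Omega>"
  shows "cover A s \<le> cover B s"
  unfolding cover_def
proof (rule inf01_image_mono)
  show "(\<lambda>q. sup01 ((\<lambda>p. H p q s) ` A)) ` \<Omega> \<subseteq> {0..1}"
    using sup01_H_range assms by blast
  show "sup01 ((\<lambda>p. H p q s) ` A) \<le> sup01 ((\<lambda>p. H p q s) ` B)" if "q \<in> \<Omega>" for q
    using assms that H_range by (intro sup01_image_mono) blast+
qed

lemma cover_nonpos:
  assumes "A \<subseteq> \<Omega>" "s \<le> 0"
  shows "cover A s = 0"
proof -
  \<comment> \<open>Nonemptiness of the space enters here: an infimum over no points would be 1. An
    empty \<open>A\<close> is harmless, its supremum being 0.\<close>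
  obtain q where q: "q \<in> \<Omega>" using nonempty by blast
  have "cover A s \<le> sup01 ((\<lambda>p. H p q s) ` A)"
    unfolding cover_def using sup01_H_range assms(1) q by (intro inf01_lower) blast+
  also have "\<dots> \<le> 0"
    using H_nonpos[OF _ q assms(2)] assms(1) by (intro sup01_least) auto
  finally show ?thesis using cover_range[OF assms(1), of s] by simp
qed

lemma cover_space:
  assumes "0 < s"
  shows "cover \<Omega> s = 1"
proof -
  have "1 \<le> cover \<Omega> s"
    unfolding cover_def
  proof (rule inf01_greatest)
    fix a assume "a \<in> (\<lambda>q. sup01 ((\<lambda>p. H p q s) ` \<Omega>)) ` \<Omega>"
    then obtain q where q: "q \<in> \<Omega>" "a = sup01 ((\<lambda>p. H p q s) ` \<Omega>)" by blast
    \<comment> \<open>Every point of the space is approximated by itself.\<close>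
    have "H q q s \<le> a"
      unfolding q(2) using q(1) H_range by (intro sup01_upper) blast+
    then show "1 \<le> a" using H_self_pos[OF q(1) assms] by simp
  qed simp
  then show ?thesis using cover_range[of \<Omega> s] by simp
qed

lemma min_inf01_sup01_eq_cover:
  assumes "A \<subseteq> \<Omega>"
  shows "min (inf01 ((\<lambda>p. sup01 ((\<lambda>q. H p q s) ` \<Omega>)) ` A))
    (inf01 ((\<lambda>q. sup01 ((\<lambda>p. H p q s) ` A)) ` \<Omega>)) = cover A s" (is "min ?i _ = _")
proof -
  have sup_range: "sup01 ((\<lambda>q. H p q s) ` \<Omega>) \<in> {0..1}" if "p \<in> \<Omega>" for p
    using H_range that by (intro sup01_range) blast
  have "cover A s \<le> ?i"
  proof (cases "s \<le> 0")
    case True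
    have "?i \<in> {0..1}" using sup_range assms by (intro inf01_range) blast
    then show ?thesis using cover_nonpos[OF assms True] by simp
  next
    case False
    \<comment> \<open>For empty \<open>A\<close> this is the convention that the infimum is 1;
      otherwise each \<open>p\<close> in \<open>A\<close> is its own partner in
      \<open>\<Omega>\<close>.\<close>
    have "1 \<le> ?i"
    proof (rule inf01_greatest)
      fix a assume "a \<in> (\<lambda>p. sup01 ((\<lambda>q. H p q s) ` \<Omega>)) ` A"
      then obtain p where p: "p \<in> \<Omega>" "a = sup01 ((\<lambda>q. H p q s) ` \<Omega>)" using assms by blast
      have "H p p s \<le> a"
        unfolding p(2) using p(1) H_range by (intro sup01_upper) blast+
      then show "1 \<le> a" using H_self_pos[OF p(1)] False by simp
    qed simp
    then show ?thesis using cover_range[OF assms, of s] by simp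
  qed
  then show ?thesis by (simp add: cover_def)
qed

text \<open>With the \<open>min\<close> collapsed to \<open>cover\<close>, the remaining claims
  reduce to the range of \<open>cover\<close>, its monotonicity and its values on the whole
  space.\<close>

lemma Lambda_H_eq: "Lambda_H \<Omega> H E = left_regularization (cover (\<Omega> - E))"
proof -
  have "\<Omega> - E \<subseteq> \<Omega>" by blast
  then show ?thesis
    by (simp add: Lambda_H_def prob_hausdorff_def left_regularization_def fun_eq_iff
        min_inf01_sup01_eq_cover)
qed

lemma range_cover_subset: "A \<subseteq> \<Omega> \<Longrightarrow> range (cover A) \<subseteq> {0..1}"
  using cover_range by blast

lemma Lambda_H_in_Delta_plus: "Lambda_H \<Omega> H E \<in> Delta_plus"
  unfolding Lambda_H_eq by (intro left_regularization_in_Delta_plus range_cover_subset) blast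

text \<open>Complementation reverses inclusion, while \<open>cover\<close> and the regularization
  are increasing.\<close>

lemma Lambda_H_antimono: "E \<subseteq> F \<Longrightarrow> Lambda_H \<Omega> H F \<le> Lambda_H \<Omega> H E"
  unfolding Lambda_H_eq
  by (intro left_regularization_mono range_cover_subset cover_mono) blast+

lemma Lambda_H_empty: "Lambda_H \<Omega> H {} = eps0"
proof
  fix t :: ereal
  have rng: "range (cover \<Omega>) \<subseteq> {0..1}" by (rule range_cover_subset) simp
  show "Lambda_H \<Omega> H {} t = eps0 t"
  proof (cases "t \<le> 0")
    case True
    then show ?thesis by (simp add: Lambda_H_eq left_regularization_def eps0_def)
  next
    case False
    \<comment> \<open>The supremum runs over \<open>s\<close> strictly below \<open>t\<close>, so
      one positive \<open>s\<close> there, at which \<open>cover \<Omega>\<close> equals 1, already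
      forces the value 1.\<close>
    then obtain s where s: "0 < s" "s < t" using dense[of 0 t] by (meson not_le)
    have "1 \<le> left_regularization (cover \<Omega>) t"
      using left_regularization_upper[OF rng _ s(2)] cover_space[OF s(1)] False by simp
    then show ?thesis
      using left_regularization_range[OF rng, of t] False by (simp add: Lambda_H_eq eps0_def)
  qed
qed

end

theorem theorem5p2:
  fixes \<Omega> :: "'a set"
    and H :: "'a \<Rightarrow> 'a \<Rightarrow> ereal \<Rightarrow> real"
    and \<tau> :: "(ereal \<Rightarrow> real) \<Rightarrow> (ereal \<Rightarrow> real) \<Rightarrow> (ereal \<Rightarrow> real)"
  assumes "PM_space \<Omega> H \<tau>"
  shows "Lambda_H \<Omega> H \<in> Pow \<Omega> \<rightarrow> Delta_plus \<and>
    antimono_on (Pow \<Omega>) (Lambda_H \<Omega> H) \<and>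
    Lambda_H \<Omega> H {} = eps0 \<and>
    (\<forall>E\<in>Pow \<Omega>. \<forall>F\<in>Pow \<Omega>.
       Lambda_H \<Omega> H (E \<union> F) \<le> Pi_M (Lambda_H \<Omega> H E) (Lambda_H \<Omega> H F))"
proof -
  interpret PM_space \<Omega> H \<tau> by (rule assms)
  have "Lambda_H \<Omega> H (E \<union> F) \<le> Pi_M (Lambda_H \<Omega> H E) (Lambda_H \<Omega> H F)" for E F
    using Lambda_H_antimono[of E "E \<union> F"] Lambda_H_antimono[of F "E \<union> F"]
    by (simp add: le_fun_def Pi_M_def)
  then show ?thesis
    using Lambda_H_in_Delta_plus Lambda_H_antimono Lambda_H_empty
    by (auto intro!: monotone_onI)
qed

end
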